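(* For all integers $m\ge 3$ and $n\ge 1$, the spiral $\mathcal S_m^n$ is upper embeddable, i.e. $\gamma_M(\mathcal S_m^n)=\lfloor (n+1)/2\rfloor$. Furthermore, $\gamma_M(\mathcal S_m^n-v_{m+2n-2})=\gamma_M(\mathcal S_m^n)-1$, i.e. $v_{m+2n-2}$ is a 1-critical-vertex of $\mathcal S_m^n$.
   Context: Spiral $\mathcal S_m^n$ ($m\ge3$, $n\ge1$): the graph on vertices $v_1,\dots,v_{m+2n}$ which is the union of $p_0,p_1,\dots,p_n$, where $p_0$ is the $m$-cycle $v_1v_2\cdots v_mv_1$; for $1\le i\le m-1$, $p_i$ is the path $v_{m+2i-2}v_{m+2i-1}v_{m+2i}v_i$ (3 edges, with new internal vertices $v_{m+2i-1},v_{m+2i}$); and for $i>m-1$, $p_i$ is the path $v_{m+2i-2}v_{m+2i-1}v_{m+2i}v_{2i-m+1}$ (with new internal vertices $v_{m+2i-1},v_{m+2i}$). Its Betti number is $\beta=|E|-|V|+1=n+1$. $\gamma_M(H)$ is the maximum genus of a connected graph $H$ (largest $k$ such that $H$ embeds cellularly in the orientable surface of genus $k$); $H$ is upper embeddable if $\gamma_M(H)=\lfloor\beta(H)/2\rfloor$. A vertex $v$ is a 1-critical-vertex of $G$ if $G-v$ is connected and $\gamma_M(G-v)=\gamma_M(G)-1$. *)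

theory Defs
  imports Main
begin

(* Finite simple graphs: a vertex set V :: nat set and an edge set E of 2-element subsets of V. *)

definition wf_graph :: "nat set \<Rightarrow> nat set set \<Rightarrow> bool" where
  "wf_graph V E \<longleftrightarrow> finite V \<and> (\<forall>e\<in>E. \<exists>u v. e = {u, v} \<and> u \<noteq> v \<and> u \<in> V \<and> v \<in> V)"

definition adj_rel :: "nat set set \<Rightarrow> (nat \<times> nat) set" where
  "adj_rel E = {(u, v). {u, v} \<in> E}"

definition connected_graph :: "nat set \<Rightarrow> nat set set \<Rightarrow> bool" where
  "connected_graph V E \<longleftrightarrow> wf_graph V E \<and> V \<noteq> {} \<and>
     (\<forall>u\<in>V. \<forall>v\<in>V. (u, v) \<in> (adj_rel E)\<^sup>*)"

definition betti :: "nat set \<Rightarrow> nat set set \<Rightarrow> int" where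
  "betti V E = int (card E) - int (card V) + 1"

(* Combinatorial (Heffter--Edmonds) description of cellular embeddings in orientable
   surfaces: rotation systems. *)

definition nbrs :: "nat set set \<Rightarrow> nat \<Rightarrow> nat set" where
  "nbrs E v = {u. {v, u} \<in> E}"

definition cyclic_on :: "(nat \<Rightarrow> nat) \<Rightarrow> nat set \<Rightarrow> bool" where
  "cyclic_on f N \<longleftrightarrow> finite N \<and> bij_betw f N N \<and> (\<forall>x\<in>N. \<forall>y\<in>N. \<exists>k. (f ^^ k) x = y)"

definition rotation_system :: "nat set \<Rightarrow> nat set set \<Rightarrow> (nat \<Rightarrow> nat \<Rightarrow> nat) \<Rightarrow> bool" where
  "rotation_system V E \<sigma> \<longleftrightarrow> (\<forall>v\<in>V. cyclic_on (\<sigma> v) (nbrs E v))"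

definition darts :: "nat set set \<Rightarrow> (nat \<times> nat) set" where
  "darts E = {(u, v). {u, v} \<in> E}"

(* face-tracing permutation: dart (u,v) is followed by (v, \<sigma> v u) *)
definition face_perm :: "(nat \<Rightarrow> nat \<Rightarrow> nat) \<Rightarrow> nat \<times> nat \<Rightarrow> nat \<times> nat" where
  "face_perm \<sigma> d = (snd d, \<sigma> (snd d) (fst d))"

definition face_orbit :: "(nat \<Rightarrow> nat \<Rightarrow> nat) \<Rightarrow> nat \<times> nat \<Rightarrow> (nat \<times> nat) set" where
  "face_orbit \<sigma> d = {(face_perm \<sigma> ^^ k) d | k. True}"

definition num_faces :: "nat set set \<Rightarrow> (nat \<Rightarrow> nat \<Rightarrow> nat) \<Rightarrow> nat" where
  "num_faces E \<sigma> = (if E = {} then 1 else card (face_orbit \<sigma> ` darts E))"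

(* Euler's formula V - E + F = 2 - 2g *)
definition emb_genus :: "nat set \<Rightarrow> nat set set \<Rightarrow> (nat \<Rightarrow> nat \<Rightarrow> nat) \<Rightarrow> int" where
  "emb_genus V E \<sigma> = (2 - int (card V) + int (card E) - int (num_faces E \<sigma>)) div 2"

definition max_genus :: "nat set \<Rightarrow> nat set set \<Rightarrow> int" where
  "max_genus V E = Max {emb_genus V E \<sigma> | \<sigma>. rotation_system V E \<sigma>}"

definition upper_embeddable :: "nat set \<Rightarrow> nat set set \<Rightarrow> bool" where
  "upper_embeddable V E \<longleftrightarrow> max_genus V E = betti V E div 2"

definition del_vertex_E :: "nat set set \<Rightarrow> nat \<Rightarrow> nat set set" where
  "del_vertex_E E v = {e \<in> E. v \<notin> e}"

definition one_critical_vertex :: "nat set \<Rightarrow> nat set set \<Rightarrow> nat \<Rightarrow> bool" where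
  "one_critical_vertex V E v \<longleftrightarrow> v \<in> V \<and>
     connected_graph (V - {v}) (del_vertex_E E v) \<and>
     max_genus (V - {v}) (del_vertex_E E v) = max_genus V E - 1"

(* The spiral S_m^n on vertices v_1,...,v_{m+2n}, vertex v_i represented by the number i. *)
definition spiral_V :: "nat \<Rightarrow> nat \<Rightarrow> nat set" where
  "spiral_V m n = {1 .. m + 2 * n}"

definition spiral_end :: "nat \<Rightarrow> nat \<Rightarrow> nat" where
  "spiral_end m i = (if i \<le> m - 1 then i else 2 * i - m + 1)"

definition spiral_E :: "nat \<Rightarrow> nat \<Rightarrow> nat set set" where
  "spiral_E m n =
     {{i, i + 1} | i. 1 \<le> i \<and> i < m} \<union> {{m, 1}} \<union>
     (\<Union>i\<in>{1..n}. {{m + 2 * i - 2, m + 2 * i - 1},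
                      {m + 2 * i - 1, m + 2 * i},
                      {m + 2 * i, spiral_end m i}})"

end

theory Submission
  imports Defs
begin

text \<open>
  A one-face rotation system stays one-face when a pendant vertex is added, and also when two
  edges sharing an endpoint \<open>z\<close> are added, provided they are inserted into corners of the single
  facial walk in the right order; adding one edge gives at most two faces. The ears \<open>p_(n+1)\<close> and
  \<open>p_(n+2)\<close> meet in a vertex \<open>z\<close> of degree three, so together they amount to pendant vertices
  followed by two edges at \<open>z\<close>. Hence a spiral with \<open>n\<close> odd has a one-face embedding, one with \<open>n\<close>
  even has an embedding with at most two faces, and Euler's formula shows that both are optimal.
  Deleting \<open>v_(m+2n-2)\<close> for \<open>n \<ge> 2\<close> leaves the spiral with \<open>n - 2\<close> ears and some pendant paths; for
  \<open>n = 1\<close> it leaves a path.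
\<close>

section \<open>Cyclic permutations\<close>

definition reach :: "('a \<Rightarrow> 'a) \<Rightarrow> 'a \<Rightarrow> 'a \<Rightarrow> bool" where
  "reach f x y \<longleftrightarrow> (\<exists>k. (f ^^ k) x = y)"

text \<open>Bijectivity on \<open>N\<close> follows from finiteness and mutual reachability, see
  \<open>cyc_surj\<close> and \<open>cyc_inj_on\<close>. The type is polymorphic so that rotations
  at a vertex and face permutations on darts share one theory.\<close>

definition cyc :: "('a \<Rightarrow> 'a) \<Rightarrow> 'a set \<Rightarrow> bool" where
  "cyc f N \<longleftrightarrow> finite N \<and> f ` N \<subseteq> N \<and> (\<forall>x\<in>N. \<forall>y\<in>N. reach f x y)"

definition insert_after :: "'a \<Rightarrow> 'a \<Rightarrow> ('a \<Rightarrow> 'a) \<Rightarrow> 'a \<Rightarrow> 'a" where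
  "insert_after x y f = f(x := y, y := f x)"

lemma reach_refl [simp]: "reach f x x"
  unfolding reach_def by (rule exI[of _ 0]) simp

lemma reach_step: "reach f (f x) y \<Longrightarrow> reach f x y"
  unfolding reach_def by (metis comp_apply funpow_Suc_right)

lemma reach_trans: "reach f x y \<Longrightarrow> reach f y z \<Longrightarrow> reach f x z"
  unfolding reach_def by (metis comp_apply funpow_add)

lemma reach_apply: "reach f x (f x)"
  by (rule reach_step) simp

lemma reach_induct [consumes 1, case_names refl step]:
  assumes "reach f x y" "P x" "\<And>y. reach f x y \<Longrightarrow> P y \<Longrightarrow> P (f y)"
  shows "P y"
proof -
  have "reach f x ((f ^^ k) x) \<and> P ((f ^^ k) x)" for k
    by (induction k) (auto simp: assms(2) intro: assms(3) reach_trans reach_apply)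
  with assms(1) show ?thesis unfolding reach_def by blast
qed

lemma reach_converse_induct [consumes 1, case_names refl step]:
  assumes "reach f x y" "P y" "\<And>x. P (f x) \<Longrightarrow> P x"
  shows "P x"
proof -
  have "P ((f ^^ k) x) \<Longrightarrow> P x" for k
    by (induction k) (auto intro: assms(3))
  with assms(1,2) show ?thesis unfolding reach_def by blast
qed

lemma reach_closed:
  assumes "reach f x y" "x \<in> N" "f ` N \<subseteq> N"
  shows "y \<in> N"
  using assms by (induction rule: reach_induct) auto

text \<open>Concatenating the \<open>g\<close>-paths that replace single \<open>f\<close>-steps
  gives the whole path. When a cycle is modified, only the altered steps then need an
  argument.\<close>

lemma reach_mono:
  assumes "reach f x y" "x \<in> N" "f ` N \<subseteq> N" "\<And>p. p \<in> N \<Longrightarrow> reach g p (f p)"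
  shows "reach g x y"
  using assms(1) by (induction rule: reach_induct)
    (auto intro: reach_trans assms reach_closed[OF _ assms(2,3)])

text \<open>The cycle through \<open>f y\<close> comes back to \<open>y\<close>; the point just
  before that return is the preimage.\<close>

lemma cyc_surj: "cyc f N \<Longrightarrow> f ` N = N"
proof (intro equalityI subsetI)
  fix y assume c: "cyc f N" and y: "y \<in> N"
  then have "f y \<in> N" by (auto simp: cyc_def)
  with c y obtain k where "(f ^^ k) (f y) = y" unfolding cyc_def reach_def by blast
  then have "f ((f ^^ k) y) = y" by (simp add: funpow_swap1)
  moreover have "(f ^^ k) y \<in> N"
    using c y reach_closed[of f y "(f ^^ k) y" N] unfolding cyc_def reach_def by blast
  ultimately show "y \<in> f ` N" by force
qed (auto simp: cyc_def)

lemma cyc_inj_on: "cyc f N \<Longrightarrow> inj_on f N"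
  by (simp add: cyc_surj cyc_def eq_card_imp_inj_on)

lemma cyclic_on_iff_cyc: "cyclic_on f N \<longleftrightarrow> cyc f N"
  using cyc_surj[of f N] cyc_inj_on[of f N]
  by (auto simp: cyclic_on_def cyc_def reach_def bij_betw_def)

lemma cyc_cong:
  assumes "cyc f N" "\<And>x. x \<in> N \<Longrightarrow> g x = f x"
  shows "cyc g N"
  unfolding cyc_def
proof (intro conjI ballI)
  have N: "f ` N \<subseteq> N" using assms(1) by (simp add: cyc_def)
  show "g ` N \<subseteq> N" using N assms(2) by auto
  fix x y assume "x \<in> N" "y \<in> N"
  with assms(1) have "reach f x y" by (simp add: cyc_def)
  then show "reach g x y"
    by (rule reach_mono[OF _ \<open>x \<in> N\<close> N]) (metis assms(2) reach_apply)
qed (use assms in \<open>simp add: cyc_def\<close>)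

lemma cyc_singleton: "f x = x \<Longrightarrow> cyc f {x}"
  by (simp add: cyc_def)

text \<open>Every old step survives except the one at \<open>x\<close>, which becomes the detour
  from \<open>x\<close> over \<open>y\<close> to \<open>f x\<close>.\<close>

lemma cyc_insert_after:
  assumes "cyc f N" "x \<in> N" "y \<notin> N"
  shows "cyc (insert_after x y f) (insert y N)"
proof -
  let ?g = "insert_after x y f"
  have N: "f ` N \<subseteq> N" and fx: "f x \<in> N" using assms by (auto simp: cyc_def)
  have xy: "x \<noteq> y" using assms by auto
  have gx: "?g x = y" and gy: "?g y = f x" using xy by (auto simp: insert_after_def)
  have step: "reach ?g p (f p)" if "p \<in> N" for p
  proof (cases "p = x")
    case True
    then show ?thesis by (metis gx gy reach_apply reach_step)
  next
    case False
    then have "?g p = f p" using that assms(3) by (auto simp: insert_after_def)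
    then show ?thesis by (metis reach_apply)
  qed
  have NN: "reach ?g p q" if "p \<in> N" "q \<in> N" for p q
    using assms(1) that by (intro reach_mono[OF _ that(1) N step]) (auto simp: cyc_def)
  have Ny: "reach ?g p y" if "p \<in> N" for p
    using NN[OF that assms(2)] by (metis gx reach_apply reach_trans)
  have yN: "reach ?g y p" if "p \<in> N" for p
    using NN[OF fx that] by (metis gy reach_step)
  show ?thesis unfolding cyc_def
  proof (intro conjI ballI)
    show "?g ` insert y N \<subseteq> insert y N" using N fx by (auto simp: insert_after_def)
    show "reach ?g p q" if "p \<in> insert y N" "q \<in> insert y N" for p q
      using that NN Ny yN by auto
  qed (use assms in \<open>simp add: cyc_def\<close>)
qed

text \<open>\<open>run f S p q\<close>: iterating \<open>f\<close> from \<open>p\<close> reaches \<open>q\<close> without leaving any point of \<open>S\<close> on the way;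
  for \<open>q \<in> S\<close> this says that \<open>q\<close> is the first hit of \<open>S\<close>, with \<open>p\<close> itself counted.\<close>
definition run :: "('a \<Rightarrow> 'a) \<Rightarrow> 'a set \<Rightarrow> 'a \<Rightarrow> 'a \<Rightarrow> bool" where
  "run f S = (\<lambda>p q. p \<notin> S \<and> q = f p)\<^sup>*\<^sup>*"

lemma run_from_stop: "run f S s t \<Longrightarrow> s \<in> S \<Longrightarrow> t = s"
  unfolding run_def by (erule converse_rtranclpE) auto

lemma run_exists:
  assumes "reach f x s" "s \<in> S"
  shows "\<exists>t\<in>S. run f S x t"
  using assms(1)
proof (induction rule: reach_converse_induct)
  case refl
  then show ?case using assms(2) by (auto simp: run_def)
next
  case (step x)
  then show ?case
    by (cases "x \<in> S") (auto simp: run_def intro: converse_rtranclp_into_rtranclp)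
qed

text \<open>A run applies \<open>f\<close> only at points outside \<open>S\<close>, so any map
  agreeing with \<open>f\<close> there follows the same trajectory.\<close>

lemma run_reach:
  assumes "run f S x t" "\<And>p. p \<notin> S \<Longrightarrow> g p = f p"
  shows "reach g x t"
  using assms(1) unfolding run_def
  by (induction rule: converse_rtranclp_induct) (auto intro: reach_step simp flip: assms(2))

text \<open>If \<open>T\<close> is closed under first return to \<open>S\<close>, the points whose
  run ends in \<open>T\<close> form an \<open>f\<close>-closed set. Cyclicity puts all of
  \<open>S\<close> into it, and a run starting in \<open>S\<close> stops at once.\<close>

lemma run_no_proper_closed_subset:
  assumes "cyc f N" "S \<subseteq> N" "T \<subseteq> S" "T \<noteq> {}" "\<And>t. t \<in> T \<Longrightarrow> \<exists>t'\<in>T. run f S (f t) t'"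
  shows "T = S"
proof -
  let ?Y = "{y. \<exists>t\<in>T. run f S y t}"
  have "f ` ?Y \<subseteq> ?Y"
  proof clarify
    fix y t assume "run f S y t" "t \<in> T"
    then show "\<exists>t\<in>T. run f S (f y) t"
      unfolding run_def by (cases rule: converse_rtranclpE) (use assms(5) in \<open>auto simp: run_def\<close>)
  qed
  moreover obtain t where t: "t \<in> T" using assms(4) by auto
  moreover have "t \<in> ?Y" using t by (auto simp: run_def)
  moreover have "reach f t s" if "s \<in> S" for s
    using that t assms(1-3) unfolding cyc_def by blast
  ultimately have "S \<subseteq> ?Y" using reach_closed[of f t _ ?Y] by blast
  then show ?thesis using run_from_stop assms(3) by fastforce
qed

text \<open>For distinct points this is \<open>f\<close> precomposed with the 3-cycle from
  \<open>x\<close> to \<open>y\<close> to \<open>z\<close>. A 3-cycle is even, so parity does not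
  forbid that one cycle stays one cycle.\<close>

definition rotate3 :: "'a \<Rightarrow> 'a \<Rightarrow> 'a \<Rightarrow> ('a \<Rightarrow> 'a) \<Rightarrow> 'a \<Rightarrow> 'a" where
  "rotate3 x y z f = f(x := f y, y := f z, z := f x)"

text \<open>\<open>f\<close> decomposes into the arcs from \<open>f x\<close> to \<open>y\<close>,
  from \<open>f y\<close> to \<open>z\<close> and from \<open>f z\<close> to \<open>x\<close>. The
  new map joins these arcs in the opposite cyclic order, again into one cycle. Were \<open>f\<close>
  to meet the points in the order \<open>x\<close>, \<open>z\<close>, \<open>y\<close>, each arc
  would close up on itself.\<close>

lemma cyc_rotate3_run:
  assumes c: "cyc f N" and N: "{x, y, z} \<subseteq> N" and d: "x \<noteq> y" "x \<noteq> z" "y \<noteq> z"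
    and r: "run f {x, y, z} (f x) y" "run f {x, y, z} (f y) z" "run f {x, y, z} (f z) x"
  shows "cyc (rotate3 x y z f) N"
proof -
  let ?g = "rotate3 x y z f"
  have g: "?g x = f y" "?g y = f z" "?g z = f x" and
    off: "\<And>p. p \<notin> {x, y, z} \<Longrightarrow> ?g p = f p"
    using d by (auto simp: rotate3_def)
  have R: "reach ?g (f x) y" "reach ?g (f y) z" "reach ?g (f z) x"
    using r off by (metis run_reach)+
  have h: "reach ?g x z" "reach ?g z y" "reach ?g y x"
    using R g by (metis reach_step)+
  have step: "reach ?g p (f p)" for p
  proof (cases "p \<in> {x, y, z}")
    case True
    then show ?thesis using h g by (metis empty_iff insertE reach_apply reach_trans)
  next
    case False
    then show ?thesis by (metis off reach_apply)
  qed
  have fN: "f ` N \<subseteq> N" using c by (simp add: cyc_def)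
  show ?thesis unfolding cyc_def
  proof (intro conjI ballI)
    show "?g ` N \<subseteq> N" using fN N by (auto simp: rotate3_def)
    show "reach ?g p q" if "p \<in> N" "q \<in> N" for p q
      using c that by (intro reach_mono[OF _ that(1) fN step]) (auto simp: cyc_def)
  qed (use c in \<open>simp add: cyc_def\<close>)
qed

text \<open>The first-return map to \<open>{x, y, z}\<close> is a 3-cycle; its direction decides which alternative holds.\<close>
lemma cyc_rotate3:
  assumes c: "cyc f N" and N: "{x, y, z} \<subseteq> N" and d: "x \<noteq> y" "x \<noteq> z" "y \<noteq> z"
  shows "cyc (rotate3 x y z f) N \<or> cyc (rotate3 x z y f) N"
proof -
  let ?S = "{x, y, z}"
  have ex: "\<exists>t\<in>?S. run f ?S (f s) t" if "s \<in> ?S" for s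
    using that c N by (intro run_exists[of f _ x]) (auto simp: cyc_def image_subset_iff)
  obtain x' y' z' where r: "x' \<in> ?S" "run f ?S (f x) x'" "y' \<in> ?S" "run f ?S (f y) y'"
      "z' \<in> ?S" "run f ?S (f z) z'"
    using ex[of x] ex[of y] ex[of z] by auto
  have no: "\<not> (\<forall>t\<in>T. \<exists>t'\<in>T. run f ?S (f t) t')" if "T \<subseteq> ?S" "T \<noteq> {}" "T \<noteq> ?S" for T
    using run_no_proper_closed_subset[OF c N that(1,2)] that(3) by blast
  have ne: "{x} \<noteq> ?S" "{y} \<noteq> ?S" "{z} \<noteq> ?S" "{x, y} \<noteq> ?S" "{x, z} \<noteq> ?S" "{y, z} \<noteq> ?S"
    using d by (auto dest!: equalityD2)
  \<comment> \<open>A fixed point or a 2-cycle of the first-return map would be a proper closed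
    subset; only the two 3-cycles remain.\<close>
  have "x' \<noteq> x" using no[of "{x}"] ne r by blast
  moreover have "y' \<noteq> y" using no[of "{y}"] ne r by blast
  moreover have "z' \<noteq> z" using no[of "{z}"] ne r by blast
  moreover have "\<not> (x' = y \<and> y' = x)" using no[of "{x, y}"] ne r by blast
  moreover have "\<not> (x' = z \<and> z' = x)" using no[of "{x, z}"] ne r by blast
  moreover have "\<not> (y' = z \<and> z' = y)" using no[of "{y, z}"] ne r by blast
  ultimately consider "x' = y" "y' = z" "z' = x" | "x' = z" "z' = y" "y' = x"
    using r by auto
  then show ?thesis
  proof cases
    case 1
    then show ?thesis using cyc_rotate3_run[OF c N d] r by simp
  next
    case 2
    have "?S = {x, z, y}" by auto
    then show ?thesis using cyc_rotate3_run[OF c, of x z y] r 2 d N by simp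
  qed
qed

text \<open>Injectivity on a finite invariant set makes every step reversible, so orbits are
  equivalence classes. This is what lets faces be counted by representatives.\<close>

lemma orbit_eq:
  assumes "finite N" "inj_on f N" "f ` N \<subseteq> N" "x \<in> N" "reach f x y"
  shows "reach f y = reach f x"
proof -
  \<comment> \<open>The orbit of \<open>p\<close> is mapped injectively into itself, hence onto. So
    \<open>p = f q\<close> for some \<open>q\<close> in it, and the number of steps from
    \<open>p\<close> to \<open>q\<close> also leads from \<open>f p\<close> to
    \<open>p\<close>.\<close>
  have reach_back: "reach f (f p) p" if p: "p \<in> N" for p
  proof -
    let ?A = "Collect (reach f p)"
    have "?A \<subseteq> N" using reach_closed[OF _ p assms(3)] by auto
    then have "finite ?A" "inj_on f ?A" using assms inj_on_subset finite_subset by metis+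
    moreover have sub: "f ` ?A \<subseteq> ?A" by (auto intro: reach_trans reach_apply)
    ultimately have "f ` ?A = ?A" by (metis endo_inj_surj)
    moreover have "p \<in> ?A" by simp
    ultimately obtain q where q: "reach f p q" "f q = p" by (metis imageE mem_Collect_eq)
    then obtain k where "(f ^^ k) p = q" by (auto simp: reach_def)
    then have "(f ^^ k) (f p) = p" using q funpow_swap1[of f k p] by simp
    then show ?thesis by (auto simp: reach_def)
  qed
  have "reach f y x"
    using assms(5)
  proof (induction rule: reach_induct)
    case (step q)
    then show ?case using reach_back reach_closed[OF step(1) assms(4,3)] by (metis reach_trans)
  qed simp
  with assms(5) show ?thesis by (blast intro: reach_trans)
qed

section \<open>Rotation systems and faces\<close>

lemma doubleton_in_wf:
  assumes "wf_graph V E" "{u, v} \<in> E"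
  shows "u \<in> V" "v \<in> V" "u \<noteq> v"
  using assms unfolding wf_graph_def by (metis doubleton_eq_iff)+

lemma finite_edges: "wf_graph V E \<Longrightarrow> finite E"
  unfolding wf_graph_def by (rule finite_subset[of _ "Pow V"]) auto

lemma wf_graph_insert:
  "wf_graph V E \<Longrightarrow> a \<noteq> b \<Longrightarrow> V \<subseteq> V' \<Longrightarrow> finite V' \<Longrightarrow> a \<in> V' \<Longrightarrow> b \<in> V' \<Longrightarrow>
    wf_graph V' (insert {a, b} E)"
  unfolding wf_graph_def by (metis insert_iff subset_eq)

lemma wf_graph_insert_same:
  "wf_graph V E \<Longrightarrow> a \<noteq> b \<Longrightarrow> a \<in> V \<Longrightarrow> b \<in> V \<Longrightarrow> wf_graph V (insert {a, b} E)"
  by (rule wf_graph_insert[of V]) (simp_all add: wf_graph_def)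

lemma finite_darts: "wf_graph V E \<Longrightarrow> finite (darts E)"
  by (rule finite_subset[of _ "V \<times> V"])
    (auto simp: darts_def dest: doubleton_in_wf, simp add: wf_graph_def)

lemma face_perm_darts:
  assumes "wf_graph V E" "rotation_system V E \<sigma>"
  shows "face_perm \<sigma> ` darts E \<subseteq> darts E" "inj_on (face_perm \<sigma>) (darts E)"
proof -
  have c: "bij_betw (\<sigma> v) (nbrs E v) (nbrs E v)" if "v \<in> V" for v
    using assms(2) that by (simp add: rotation_system_def cyclic_on_def)
  have n: "u \<in> nbrs E v" "v \<in> V" if "{u, v} \<in> E" for u v
    using that doubleton_in_wf[OF assms(1) that] by (auto simp: nbrs_def insert_commute)
  show "face_perm \<sigma> ` darts E \<subseteq> darts E"
    using c n by (fastforce simp: face_perm_def darts_def nbrs_def bij_betw_def)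
  show "inj_on (face_perm \<sigma>) (darts E)"
  proof (rule inj_onI)
    fix d d' assume "d \<in> darts E" "d' \<in> darts E" "face_perm \<sigma> d = face_perm \<sigma> d'"
    then obtain p p' q where d: "d = (p, q)" "d' = (p', q)" "{p, q} \<in> E" "{p', q} \<in> E"
      and eq: "\<sigma> q p = \<sigma> q p'"
      by (cases d; cases d') (auto simp: face_perm_def darts_def)
    have "inj_on (\<sigma> q) (nbrs E q)" using c n(2)[OF d(3)] by (simp add: bij_betw_def)
    then show "d = d'" using d eq n(1) by (metis inj_onD)
  qed
qed

lemma face_orbit_reach: "face_orbit \<sigma> d = Collect (reach (face_perm \<sigma>) d)"
  unfolding face_orbit_def reach_def by blast

text \<open>The lower bound limits the genus; the upper bound makes the set under \<open>Max\<close>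
  finite. The \<open>max 1\<close> covers the edgeless graph, which has one face but no
  darts.\<close>

lemma num_faces_bounds:
  assumes "wf_graph V E"
  shows "1 \<le> num_faces E \<sigma>" "num_faces E \<sigma> \<le> max 1 (card (darts E))"
proof -
  have f: "finite (darts E)" by (rule finite_darts[OF assms])
  have "darts E \<noteq> {}" if "E \<noteq> {}"
    using that assms unfolding wf_graph_def darts_def by fastforce
  then show "1 \<le> num_faces E \<sigma>"
    using f by (auto simp: num_faces_def Suc_le_eq card_gt_0_iff)
  show "num_faces E \<sigma> \<le> max 1 (card (darts E))"
    using card_image_le[OF f, of "face_orbit \<sigma>"] by (auto simp: num_faces_def)
qed

text \<open>With \<open>F\<close> faces the genus is \<open>(betti V E + 1 - F) div 2\<close>. It is
  largest for \<open>F = 1\<close>, and for odd Betti number rounding gives the same value at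
  \<open>F = 2\<close>.\<close>

lemma max_genus_eqI:
  assumes wf: "wf_graph V E" and rot: "rotation_system V E \<sigma>"
    and F: "num_faces E \<sigma> \<le> 1 \<or> num_faces E \<sigma> \<le> 2 \<and> odd (betti V E)"
  shows "max_genus V E = betti V E div 2"
  unfolding max_genus_def
proof (rule Max_eqI)
  let ?G = "{emb_genus V E \<sigma> | \<sigma>. rotation_system V E \<sigma>}"
  have "?G \<subseteq> (\<lambda>F. (2 - int (card V) + int (card E) - int F) div 2) ` {0..max 1 (card (darts E))}"
    using num_faces_bounds[OF wf] by (auto simp: emb_genus_def)
  then show "finite ?G" by (rule finite_subset) simp
  show le: "g \<le> betti V E div 2" if "g \<in> ?G" for g
    using that num_faces_bounds(1)[OF wf] by (force simp: emb_genus_def betti_def intro!: zdiv_mono1)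
  have "betti V E div 2 \<le> emb_genus V E \<sigma>"
    using F unfolding emb_genus_def betti_def by presburger
  with le rot show "betti V E div 2 \<in> ?G" by (force intro: antisym)
qed

section \<open>Unicellular graphs\<close>

text \<open>Forbidding isolated vertices guarantees a corner at every vertex into which a new edge
  can be inserted.\<close>

definition unicellular :: "nat set \<Rightarrow> nat set set \<Rightarrow> bool" where
  "unicellular V E \<longleftrightarrow> connected_graph V E \<and> (\<forall>v\<in>V. nbrs E v \<noteq> {}) \<and>
     (\<exists>\<sigma>. rotation_system V E \<sigma> \<and> cyc (face_perm \<sigma>) (darts E))"

text \<open>Tracking the unicellular subgraph instead of an embedding with at most two faces lets pendant
  vertices be added before the last edge.\<close>
definition near_unicellular :: "nat set \<Rightarrow> nat set set \<Rightarrow> bool" where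
  "near_unicellular V E \<longleftrightarrow> (\<exists>E' a b. E = insert {a, b} E' \<and> unicellular V E' \<and>
     a \<in> V \<and> b \<in> V \<and> a \<noteq> b \<and> {a, b} \<notin> E')"

lemma unicellular_wf: "unicellular V E \<Longrightarrow> wf_graph V E"
  by (simp add: unicellular_def connected_graph_def)

lemma near_unicellular_connected:
  assumes "near_unicellular V E"
  shows "connected_graph V E"
proof -
  from assms obtain E' a b where E: "E = insert {a, b} E'" and u: "unicellular V E'"
    and ab: "a \<in> V" "b \<in> V" "a \<noteq> b"
    unfolding near_unicellular_def by blast
  have "(adj_rel E')\<^sup>* \<subseteq> (adj_rel E)\<^sup>*" by (rule rtrancl_mono) (auto simp: E adj_rel_def)
  moreover have "wf_graph V E"
    using unicellular_wf[OF u] ab unfolding E by (intro wf_graph_insert_same) auto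
  ultimately show ?thesis using u by (auto simp: unicellular_def connected_graph_def)
qed

lemma unicellular_max_genus:
  assumes "unicellular V E"
  shows "max_genus V E = betti V E div 2"
proof -
  from assms obtain \<sigma> where rot: "rotation_system V E \<sigma>" and c: "cyc (face_perm \<sigma>) (darts E)"
    by (auto simp: unicellular_def)
  have "face_orbit \<sigma> d = darts E" if "d \<in> darts E" for d
    using c that by (auto simp: face_orbit_reach cyc_def intro: reach_closed)
  then have "face_orbit \<sigma> ` darts E \<subseteq> {darts E}" by auto
  then have "card (face_orbit \<sigma> ` darts E) \<le> 1" using card_mono[of "{darts E}"] by fastforce
  then have "num_faces E \<sigma> \<le> 1" by (simp add: num_faces_def)
  then show ?thesis using max_genus_eqI[OF unicellular_wf[OF assms] rot] by blast
qed

text \<open>The new edge \<open>{v, w}\<close> enters the corner at \<open>v\<close> after \<open>u\<close> and the corner at \<open>w\<close> after \<open>t\<close>.\<close>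
definition add_edge :: "nat \<Rightarrow> nat \<Rightarrow> nat \<Rightarrow> nat \<Rightarrow> (nat \<Rightarrow> nat \<Rightarrow> nat) \<Rightarrow> nat \<Rightarrow> nat \<Rightarrow> nat" where
  "add_edge u v t w \<sigma> = \<sigma>(v := insert_after u w (\<sigma> v), w := insert_after t v (\<sigma> w))"

lemma nbrs_insert_edge:
  "nbrs (insert {v, w} E) x =
    (if x = v then insert w (nbrs E x) else if x = w then insert v (nbrs E x) else nbrs E x)"
  by (auto simp: nbrs_def doubleton_eq_iff)

lemma darts_insert_edge: "darts (insert {v, w} E) = insert (v, w) (insert (w, v) (darts E))"
  by (auto simp: darts_def doubleton_eq_iff)

lemma rotation_system_add_edge:
  assumes "rotation_system V E \<sigma>" "u \<in> nbrs E v" "t \<in> nbrs E w" "v \<noteq> w" "{v, w} \<notin> E"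
  shows "rotation_system V (insert {v, w} E) (add_edge u v t w \<sigma>)"
  using assms cyc_insert_after[of "\<sigma> v" "nbrs E v" u w] cyc_insert_after[of "\<sigma> w" "nbrs E w" t v]
  by (auto simp: rotation_system_def cyclic_on_iff_cyc add_edge_def nbrs_insert_edge)
    (auto simp: nbrs_def insert_commute)

text \<open>A walk entering either of the two corners is diverted along the new edge and continues
  as the old walk did from the other corner. No other dart changes its successor.\<close>

lemma face_perm_add_edge:
  assumes "v \<noteq> w"
  shows "face_perm (add_edge u v t w \<sigma>) = (face_perm \<sigma>)
    ((u, v) := (v, w), (w, v) := face_perm \<sigma> (u, v), (t, w) := (w, v), (v, w) := face_perm \<sigma> (t, w))"
  using assms by (auto simp: fun_eq_iff face_perm_def add_edge_def insert_after_def)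

text \<open>Inserting the extra edge leaves at most two faces, since every face passes through one
  of the corner darts \<open>(p, a)\<close> and \<open>(q, b)\<close>.\<close>

lemma near_unicellular_max_genus:
  assumes near: "near_unicellular V E" and odd: "odd (betti V E)"
  shows "max_genus V E = betti V E div 2"
proof -
  from near obtain E' a b where E: "E = insert {a, b} E'" and u: "unicellular V E'"
    and ab: "a \<in> V" "b \<in> V" "a \<noteq> b" "{a, b} \<notin> E'"
    unfolding near_unicellular_def by blast
  from u ab obtain \<sigma> p q where rot: "rotation_system V E' \<sigma>" and c: "cyc (face_perm \<sigma>) (darts E')"
    and p: "p \<in> nbrs E' a" and q: "q \<in> nbrs E' b"
    unfolding unicellular_def by blast
  let ?\<sigma> = "add_edge p a q b \<sigma>"
  let ?f = "face_perm \<sigma>" and ?g = "face_perm ?\<sigma>"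
  have rot': "rotation_system V E ?\<sigma>"
    unfolding E by (rule rotation_system_add_edge) (use rot p q ab in auto)
  have wf: "wf_graph V E" using near_unicellular_connected[OF near] by (simp add: connected_graph_def)
  have pD: "(p, a) \<in> darts E'" "(q, b) \<in> darts E'" 
    and abD: "(a, b) \<notin> darts E'" "(b, a) \<notin> darts E'"
    using p q ab by (auto simp: nbrs_def darts_def insert_commute)
  have fD: "?f ` darts E' \<subseteq> darts E'" using c by (simp add: cyc_def)
  \<comment> \<open>The single cycle of \<open>?f\<close> arrives at a corner dart, and
    \<open>?g\<close> agrees with \<open>?f\<close> up to the first such arrival.\<close>
  have to: "\<exists>d\<in>{(p, a), (q, b)}. reach ?g x d" if x: "x \<in> darts E'" for x
  proof -
    have "reach ?f x (p, a)" using c x pD by (simp add: cyc_def)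
    then have "x \<in> darts E' \<longrightarrow> ?thesis"
    proof (induction rule: reach_converse_induct)
      case (step x)
      show ?case
      proof (cases "x \<in> {(p, a), (q, b)}")
        case True
        then show ?thesis by (intro impI bexI[of _ x]) simp_all
      next
        case False
        show ?thesis
        proof
          assume "x \<in> darts E'"
          then have "?g x = ?f x" and "?f x \<in> darts E'"
            using False ab abD fD by (auto simp: face_perm_add_edge)
          with step obtain d where "d \<in> {(p, a), (q, b)}" "reach ?g (?g x) d" by auto
          then show "\<exists>d\<in>{(p, a), (q, b)}. reach ?g x d" by (auto dest: reach_step)
        qed
      qed
    qed auto
    then show ?thesis using x by blast
  qed
  \<comment> \<open>Each of the two darts of the new edge is followed by an old dart.\<close>
  have to': "\<exists>d\<in>{(p, a), (q, b)}. reach ?g x d" if x: "x \<in> darts E" for x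
  proof (cases "x \<in> darts E'")
    case False
    then have "?g x \<in> darts E'"
      using x ab pD fD by (auto simp: E darts_insert_edge face_perm_add_edge)
    from to[OF this] obtain d where "d \<in> {(p, a), (q, b)}" "reach ?g (?g x) d" by auto
    then show ?thesis by (auto dest: reach_step)
  qed (rule to)
  have "face_orbit ?\<sigma> x \<in> face_orbit ?\<sigma> ` {(p, a), (q, b)}" if x: "x \<in> darts E" for x
    using to'[OF x] orbit_eq[OF finite_darts[OF wf] face_perm_darts(2,1)[OF wf rot'] x]
    unfolding face_orbit_reach by (metis imageI)
  then have "face_orbit ?\<sigma> ` darts E \<subseteq> face_orbit ?\<sigma> ` {(p, a), (q, b)}" by blast
  then have "card (face_orbit ?\<sigma> ` darts E) \<le> card (face_orbit ?\<sigma> ` {(p, a), (q, b)})"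
    by (intro card_mono) auto
  also have "\<dots> \<le> 2" by (rule order_trans[OF card_image_le]) (auto simp: card_insert_if)
  finally have "num_faces E ?\<sigma> \<le> 2" by (simp add: num_faces_def)
  then show ?thesis using max_genus_eqI[OF wf rot'] odd by blast
qed

section \<open>Pendant vertices\<close>

lemma connected_graph_pendant:
  assumes "connected_graph V E" "v \<in> V" "w \<notin> V"
  shows "connected_graph (insert w V) (insert {v, w} E)"
proof -
  let ?R = "adj_rel E" and ?R' = "adj_rel (insert {v, w} E)"
  have "?R\<^sup>* \<subseteq> ?R'\<^sup>*" by (rule rtrancl_mono) (auto simp: adj_rel_def)
  then have VV: "(x, y) \<in> ?R'\<^sup>*" if "x \<in> V" "y \<in> V" for x y
    using assms(1) that unfolding connected_graph_def by blast
  have vw: "(v, w) \<in> ?R'" "(w, v) \<in> ?R'" by (auto simp: adj_rel_def insert_commute)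
  have "(x, w) \<in> ?R'\<^sup>*" "(w, x) \<in> ?R'\<^sup>*" if "x \<in> V" for x
    using VV[OF that assms(2)] VV[OF assms(2) that] vw
    by (auto intro: rtrancl_into_rtrancl converse_rtrancl_into_rtrancl)
  with VV have "\<forall>x\<in>insert w V. \<forall>y\<in>insert w V. (x, y) \<in> ?R'\<^sup>*" by auto
  moreover have "wf_graph (insert w V) (insert {v, w} E)"
    using assms by (intro wf_graph_insert[of V]) (auto simp: connected_graph_def wf_graph_def)
  ultimately show ?thesis by (simp add: connected_graph_def)
qed

text \<open>The facial walk only gains a detour: after \<open>(u, v)\<close> it runs through
  \<open>(v, w)\<close> and \<open>(w, v)\<close>, then goes on as before.\<close>

lemma unicellular_pendant:
  assumes "unicellular V E" "v \<in> V" "w \<notin> V"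
  shows "unicellular (insert w V) (insert {v, w} E)"
proof -
  from assms obtain \<sigma> u where rot: "rotation_system V E \<sigma>" and c: "cyc (face_perm \<sigma>) (darts E)"
    and u: "u \<in> nbrs E v"
    unfolding unicellular_def by blast
  note wf = unicellular_wf[OF assms(1)]
  have vw: "v \<noteq> w" using assms by auto
  have now: "w \<notin> nbrs E x" "nbrs E w = {}" for x
    using assms(3) by (auto simp: nbrs_def dest: doubleton_in_wf[OF wf])
  have noD: "(x, w) \<notin> darts E" "(w, x) \<notin> darts E" for x
    using assms(3) by (auto simp: darts_def dest: doubleton_in_wf[OF wf])
  let ?\<sigma> = "\<sigma>(v := insert_after u w (\<sigma> v), w := \<lambda>_. v)"
  have "rotation_system (insert w V) (insert {v, w} E) ?\<sigma>"
    using rot cyc_insert_after[of "\<sigma> v" "nbrs E v" u w] u vw assms(2,3)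
    by (auto simp: rotation_system_def cyclic_on_iff_cyc nbrs_insert_edge now cyc_singleton)
  moreover have "cyc (face_perm ?\<sigma>) (darts (insert {v, w} E))"
  proof (rule cyc_cong)
    let ?g = "insert_after (v, w) (w, v) (insert_after (u, v) (v, w) (face_perm \<sigma>))"
    have "(u, v) \<in> darts E" using u by (simp add: nbrs_def darts_def insert_commute)
    then have "cyc ?g (insert (w, v) (insert (v, w) (darts E)))"
      using c vw noD by (intro cyc_insert_after) auto
    then show "cyc ?g (darts (insert {v, w} E))"
      by (simp add: darts_insert_edge insert_commute)
    show "face_perm ?\<sigma> x = ?g x" if "x \<in> darts (insert {v, w} E)" for x
      using that vw noD by (cases x) (auto simp: darts_insert_edge face_perm_def insert_after_def)
  qed
  ultimately show ?thesis
    using assms connected_graph_pendant[of V E v w]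
    by (auto simp: unicellular_def nbrs_insert_edge)
qed

text \<open>The pendant vertex is attached to the unicellular subgraph and the extra edge is put
  back afterwards.\<close>

lemma near_unicellular_pendant:
  assumes "near_unicellular V E" "v \<in> V" "w \<notin> V"
  shows "near_unicellular (insert w V) (insert {v, w} E)"
proof -
  from assms(1) obtain E' a b where E: "E = insert {a, b} E'" and u: "unicellular V E'"
    and ab: "a \<in> V" "b \<in> V" "a \<noteq> b" "{a, b} \<notin> E'"
    unfolding near_unicellular_def by blast
  show ?thesis unfolding near_unicellular_def
    using unicellular_pendant[OF u assms(2,3)] ab assms(3)
    by (intro exI[of _ "insert {v, w} E'"] exI[of _ a] exI[of _ b])
      (auto simp: E doubleton_eq_iff)
qed

section \<open>Two new edges at a common vertex\<close>

text \<open>The right side applies \<open>face_perm_add_edge\<close> twice, with \<open>x\<close>,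
  \<open>y\<close>, \<open>z\<close> the corner darts and \<open>e1\<close> to \<open>e4\<close> the
  new darts. The left side shows that, apart from splicing in the new darts, the effect is
  \<open>rotate3\<close>.\<close>

lemma insertions_rotate3:
  assumes "distinct [x, y, z, e1, e2, e3, e4]"
  shows "insert_after e2 e3 (insert_after y e2 (insert_after z e4 (insert_after x e1 (rotate3 x y z f)))) =
    (let g = f(x := e3, e4 := f x, z := e4, e3 := f z)
     in g(x := e1, e2 := g x, y := e2, e1 := g y))" (is "?l = ?r")
proof (rule ext)
  fix u
  have ne: "x \<noteq> y" "x \<noteq> z" "x \<noteq> e1" "x \<noteq> e2" "x \<noteq> e3" "x \<noteq> e4" "y \<noteq> z"
    "y \<noteq> e1" "y \<noteq> e2" "y \<noteq> e3" "y \<noteq> e4" "z \<noteq> e1" "z \<noteq> e2" "z \<noteq> e3"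
    "z \<noteq> e4" "e1 \<noteq> e2" "e1 \<noteq> e3" "e1 \<noteq> e4" "e2 \<noteq> e3" "e2 \<noteq> e4" "e3 \<noteq> e4"
    using assms by simp_all
  consider "u = x" | "u = y" | "u = z" | "u = e1" | "u = e2" | "u = e3" | "u = e4" |
    "u \<notin> {x, y, z, e1, e2, e3, e4}" by auto
  then show "?l u = ?r u"
    by cases (simp_all add: insert_after_def rotate3_def Let_def ne ne[symmetric])
qed

text \<open>Both edges enter the corner at \<open>z\<close> after \<open>r\<close>, with
  \<open>{z, b}\<close> inserted first.\<close>

lemma unicellular_add_edges_rotate3:
  assumes uni: "unicellular V E" and V: "z \<in> V" "a \<in> V" "b \<in> V"
    and d: "z \<noteq> a" "z \<noteq> b" "a \<noteq> b" "{z, a} \<notin> E" "{z, b} \<notin> E"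
    and rot: "rotation_system V E \<sigma>"
    and n: "r \<in> nbrs E z" "p \<in> nbrs E a" "q \<in> nbrs E b"
    and c: "cyc (rotate3 (r, z) (p, a) (q, b) (face_perm \<sigma>)) (darts E)"
  shows "unicellular V (insert {z, a} (insert {z, b} E))"
proof -
  let ?\<sigma>1 = "add_edge r z q b \<sigma>"
  let ?\<sigma> = "add_edge r z p a ?\<sigma>1"
  let ?E1 = "insert {z, b} E"
  let ?E = "insert {z, a} ?E1"
  have rot1: "rotation_system V ?E1 ?\<sigma>1"
    by (rule rotation_system_add_edge) (use rot n d in auto)
  have rot2: "rotation_system V ?E ?\<sigma>"
    by (rule rotation_system_add_edge[OF rot1])
      (use n d in \<open>auto simp: nbrs_insert_edge doubleton_eq_iff\<close>)
  have D: "(r, z) \<in> darts E" "(p, a) \<in> darts E" "(q, b) \<in> darts E"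
    and noD: "(z, a) \<notin> darts E" "(a, z) \<notin> darts E" "(z, b) \<notin> darts E" "(b, z) \<notin> darts E"
    using n d by (auto simp: nbrs_def darts_def insert_commute)
  \<comment> \<open>From the inside out, each insertion follows a dart already on the cycle;
    \<open>(z, b)\<close> comes after \<open>(a, z)\<close>, itself new.\<close>
  let ?g = "insert_after (a, z) (z, b) (insert_after (p, a) (a, z) (insert_after (q, b) (b, z)
      (insert_after (r, z) (z, a) (rotate3 (r, z) (p, a) (q, b) (face_perm \<sigma>)))))"
  have "cyc ?g (insert (z, b) (insert (a, z) (insert (b, z) (insert (z, a) (darts E)))))"
    using c D noD d by (intro cyc_insert_after) auto
  also have "insert (z, b) (insert (a, z) (insert (b, z) (insert (z, a) (darts E)))) = darts ?E"
    by (auto simp: darts_insert_edge)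
  also have "?g = face_perm ?\<sigma>"
  proof -
    have "distinct [(r, z), (p, a), (q, b), (z, a), (a, z), (z, b), (b, z)]"
      using D noD d by auto
    from insertions_rotate3[OF this] show ?thesis
      unfolding face_perm_add_edge[OF d(1)] face_perm_add_edge[OF d(2)] by (simp add: Let_def)
  qed
  finally have c2: "cyc (face_perm ?\<sigma>) (darts ?E)" .
  have "(adj_rel E)\<^sup>* \<subseteq> (adj_rel ?E)\<^sup>*" by (rule rtrancl_mono) (auto simp: adj_rel_def)
  moreover have "wf_graph V ?E"
    using unicellular_wf[OF uni] V d by (intro wf_graph_insert_same) auto
  ultimately have "connected_graph V ?E"
    using uni unfolding unicellular_def connected_graph_def by blast
  then show ?thesis
    using uni rot2 c2 by (auto simp: unicellular_def nbrs_insert_edge)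
qed

text \<open>The two alternatives of \<open>cyc_rotate3\<close> match the two orders of inserting the
  edges at \<open>z\<close>. One of them gives a single face, and the resulting graph is the
  same.\<close>

lemma unicellular_add_adjacent_edges:
  assumes uni: "unicellular V E" and V: "z \<in> V" "a \<in> V" "b \<in> V"
    and d: "z \<noteq> a" "z \<noteq> b" "a \<noteq> b" "{z, a} \<notin> E" "{z, b} \<notin> E"
  shows "unicellular V (insert {z, a} (insert {z, b} E))"
proof -
  from uni obtain \<sigma> where rot: "rotation_system V E \<sigma>" and c: "cyc (face_perm \<sigma>) (darts E)"
    unfolding unicellular_def by blast
  have "nbrs E x \<noteq> {}" if "x \<in> V" for x using uni that by (simp add: unicellular_def)
  with V obtain r p q where n: "r \<in> nbrs E z" "p \<in> nbrs E a" "q \<in> nbrs E b"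
    by (meson ex_in_conv)
  have "{(r, z), (p, a), (q, b)} \<subseteq> darts E"
    using n by (auto simp: nbrs_def darts_def insert_commute)
  from cyc_rotate3[OF c this] d
  consider "cyc (rotate3 (r, z) (p, a) (q, b) (face_perm \<sigma>)) (darts E)"
    | "cyc (rotate3 (r, z) (q, b) (p, a) (face_perm \<sigma>)) (darts E)" by auto
  then show ?thesis
  proof cases
    case 1
    then show ?thesis using unicellular_add_edges_rotate3[OF uni V d rot n] by simp
  next
    case 2
    then have "unicellular V (insert {z, b} (insert {z, a} E))"
      using unicellular_add_edges_rotate3[OF uni V(1,3,2) _ _ _ _ _ rot n(1,3,2)] d by simp
    then show ?thesis by (simp add: insert_commute)
  qed
qed

lemma unicellular_edge:
  assumes "a \<noteq> b"
  shows "unicellular {a, b} {{a, b}}"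
proof -
  have nb: "nbrs {{a, b}} a = {b}" "nbrs {{a, b}} b = {a}"
    using assms by (auto simp: nbrs_def doubleton_eq_iff)
  have D: "darts {{a, b}} = {(a, b), (b, a)}" by (auto simp: darts_def doubleton_eq_iff)
  let ?\<sigma> = "\<lambda>v. if v = a then (\<lambda>_. b) else (\<lambda>_. a)"
  have "rotation_system {a, b} {{a, b}} ?\<sigma>"
    using assms by (auto simp: rotation_system_def cyclic_on_iff_cyc nb cyc_singleton)
  moreover have "cyc (face_perm ?\<sigma>) (darts {{a, b}})"
  proof -
    have s: "face_perm ?\<sigma> (a, b) = (b, a)" "face_perm ?\<sigma> (b, a) = (a, b)"
      using assms by (auto simp: face_perm_def)
    show ?thesis using reach_apply[of "face_perm ?\<sigma>" "(a, b)"] reach_apply[of "face_perm ?\<sigma>" "(b, a)"]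
      by (auto simp: D cyc_def s)
  qed
  moreover have "connected_graph {a, b} {{a, b}}"
  proof -
    have "(a, b) \<in> adj_rel {{a, b}}" "(b, a) \<in> adj_rel {{a, b}}"
      by (auto simp: adj_rel_def insert_commute)
    then show ?thesis using assms by (auto simp: connected_graph_def wf_graph_def)
  qed
  ultimately show ?thesis by (auto simp: unicellular_def nb)
qed

section \<open>Betti numbers and well-formedness under insertions\<close>

lemma betti_pendant:
  assumes "wf_graph V E" "w \<notin> V"
  shows "betti (insert w V) (insert {v, w} E) = betti V E"
proof -
  have "{v, w} \<notin> E" using assms(2) by (auto dest: doubleton_in_wf[OF assms(1)])
  then show ?thesis
    using finite_edges[OF assms(1)] assms by (simp add: betti_def wf_graph_def)
qed

lemma betti_insert_edge:
  assumes "wf_graph V E" "e \<notin> E"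
  shows "betti V (insert e E) = betti V E + 1"
  using finite_edges[OF assms(1)] assms(2) by (simp add: betti_def)

lemma wf_graph_pendant:
  "wf_graph V E \<Longrightarrow> v \<in> V \<Longrightarrow> w \<notin> V \<Longrightarrow> wf_graph (insert w V) (insert {v, w} E)"
  by (rule wf_graph_insert[of V]) (auto simp: wf_graph_def)

lemma edge_notin:
  assumes "wf_graph V E" "x \<notin> V"
  shows "{x, y} \<notin> E" "{y, x} \<notin> E"
  using assms(2) by (auto dest: doubleton_in_wf[OF assms(1)])

lemma edge_avoids:
  assumes "wf_graph V E" "x \<notin> V" "e \<in> E"
  shows "x \<notin> e"
proof -
  from assms(1,3) obtain u v where "e = {u, v}" "u \<in> V" "v \<in> V"
    unfolding wf_graph_def by metis
  with assms(2) show ?thesis by auto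
qed

section \<open>Spirals\<close>

text \<open>For \<open>k = m\<close> this is the cycle \<open>p_0\<close> without its closing edge;
  for \<open>k = m - 1\<close> it is \<open>p_0\<close> with the vertex \<open>m\<close>
  deleted.\<close>

definition path_E :: "nat \<Rightarrow> nat set set" where
  "path_E k = {{i, i + 1} | i. 1 \<le> i \<and> i < k}"

lemma path_E_Suc: "1 \<le> k \<Longrightarrow> path_E (Suc k) = insert {k, Suc k} (path_E k)"
  by (auto simp: path_E_def less_Suc_eq)

lemma path_unicellular:
  assumes "2 \<le> k"
  shows "unicellular {1..k} (path_E k) \<and> betti {1..k} (path_E k) = 0"
  using assms
proof (induction k rule: dec_induct)
  \<comment> \<open>The induction starts at two vertices, as a lone vertex has no neighbour and so
    is not \<open>unicellular\<close>.\<close>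
  case base
  have "path_E 2 = {{1, 2}}" "{1..2} = {1, 2::nat}"
    by (auto simp: path_E_def intro!: exI[of _ "1::nat"])
  then show ?case using unicellular_edge[of 1 2] by (simp add: betti_def)
next
  case (step k)
  have V: "{1..Suc k} = insert (Suc k) {1..k}" by auto
  have "k \<in> {1..k}" "Suc k \<notin> {1..k}" using step.hyps by auto
  then show ?case unfolding V
    using step path_E_Suc[of k] betti_pendant[OF unicellular_wf, of "{1..k}" "path_E k"]
      unicellular_pendant[of "{1..k}" "path_E k"] by simp
qed

lemma spiral_V_Suc: "spiral_V m (Suc n) = insert (m + 2 * n + 2) (insert (m + 2 * n + 1) (spiral_V m n))"
  by (auto simp: spiral_V_def)

lemma spiral_E_0: "spiral_E m 0 = insert {m, 1} (path_E m)"
  by (auto simp: spiral_E_def path_E_def)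

lemma spiral_E_Suc: "spiral_E m (Suc n) =
  insert {m + 2 * n + 2, spiral_end m (Suc n)} (insert {m + 2 * n + 1, m + 2 * n + 2}
    (insert {m + 2 * n, m + 2 * n + 1} (spiral_E m n)))"
proof -
  have I: "{1..Suc n} = insert (Suc n) {1..n}" by auto
  have "m + 2 * Suc n - 2 = m + 2 * n" "m + 2 * Suc n - 1 = m + 2 * n + 1"
    "m + 2 * Suc n = m + 2 * n + 2" by auto
  then show ?thesis unfolding spiral_E_def I UN_insert by (simp add: insert_commute Un_commute)
qed

text \<open>For late ears the second claim amounts to \<open>2 * k + 5 \<le> 2 * m + 2 * k\<close>.
  That the ear \<open>p_(k+2)\<close> ends on a vertex older than \<open>p_(k+1)\<close> allows both
  ears to be added together, and keeps its end clear of the deleted vertex later.\<close>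

lemma spiral_end_in:
  assumes "3 \<le> m"
  shows "spiral_end m (Suc k) \<in> spiral_V m k" "spiral_end m (Suc (Suc k)) \<in> spiral_V m k"
  using assms by (auto simp: spiral_end_def spiral_V_def)

lemma last_in_spiral_V: "3 \<le> m \<Longrightarrow> m + 2 * k \<in> spiral_V m k"
  by (simp add: spiral_V_def)

lemma spiral_0_near_unicellular:
  assumes "3 \<le> m"
  shows "near_unicellular (spiral_V m 0) (spiral_E m 0)"
proof -
  have "{m, 1} \<notin> path_E m" using assms by (auto simp: path_E_def doubleton_eq_iff)
  then show ?thesis
    using path_unicellular[of m] assms unfolding near_unicellular_def spiral_E_0 spiral_V_def
    by (intro exI[of _ "path_E m"] exI[of _ m] exI[of _ 1]) auto
qed

text \<open>An ear consists of two pendant vertices, which keep the Betti number, and a closing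
  edge, which raises it by one.\<close>

lemma spiral_wf_betti:
  assumes "3 \<le> m"
  shows "wf_graph (spiral_V m n) (spiral_E m n) \<and> betti (spiral_V m n) (spiral_E m n) = int n + 1"
proof (induction n)
  case 0
  have "{m, 1} \<notin> path_E m" using assms by (auto simp: path_E_def doubleton_eq_iff)
  then have "betti {1..m} (spiral_E m 0) = 1"
    using path_unicellular[of m] assms by (simp add: spiral_E_0 betti_insert_edge unicellular_wf)
  then show ?case
    using near_unicellular_connected[OF spiral_0_near_unicellular[OF assms]]
    by (simp add: connected_graph_def spiral_V_def)
next
  case (Suc n)
  let ?V = "spiral_V m n" and ?E = "spiral_E m n"
  let ?w1 = "m + 2 * n + 1" and ?w2 = "m + 2 * n + 2"
  let ?V2 = "insert ?w2 (insert ?w1 ?V)"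
    and ?E2 = "insert {?w1, ?w2} (insert {m + 2 * n, ?w1} ?E)"
  have fresh: "?w1 \<notin> ?V" "?w2 \<notin> insert ?w1 ?V" by (auto simp: spiral_V_def)
  note wf0 = conjunct1[OF Suc]
  note wf1 = wf_graph_pendant[OF wf0 last_in_spiral_V[OF assms] fresh(1)]
  note wf2 = wf_graph_pendant[OF wf1 insertI1 fresh(2)]
  have b2: "betti ?V2 ?E2 = int n + 1"
    using Suc betti_pendant[OF wf0 fresh(1)] betti_pendant[OF wf1 fresh(2)] by simp
  let ?e = "spiral_end m (Suc n)"
  have e: "?e \<in> ?V" by (rule spiral_end_in[OF assms])
  then have "?e \<noteq> ?w1" "?e \<noteq> ?w2" using fresh by auto
  moreover have "{?w2, ?e} \<notin> ?E" using edge_notin[OF wf0] fresh by blast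
  ultimately have "{?w2, ?e} \<notin> ?E2" by (auto simp: doubleton_eq_iff)
  moreover have "wf_graph ?V2 (insert {?w2, ?e} ?E2)"
    using e \<open>?e \<noteq> ?w2\<close> by (intro wf_graph_insert_same wf2) auto
  ultimately show ?case
    using betti_insert_edge[OF wf2] b2 unfolding spiral_V_Suc spiral_E_Suc by simp
qed

lemmas spiral_wf = conjunct1[OF spiral_wf_betti]
lemmas spiral_betti = conjunct2[OF spiral_wf_betti]

lemma spiral_Suc_near_unicellular:
  assumes m: "3 \<le> m" and u: "unicellular (spiral_V m n) (spiral_E m n)"
  shows "near_unicellular (spiral_V m (Suc n)) (spiral_E m (Suc n))"
proof -
  let ?V = "spiral_V m n" and ?E = "spiral_E m n" and ?e = "spiral_end m (Suc n)"
  let ?w1 = "m + 2 * n + 1" and ?w2 = "m + 2 * n + 2"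
  have fresh: "?w1 \<notin> ?V" "?w2 \<notin> insert ?w1 ?V" by (auto simp: spiral_V_def)
  note u1 = unicellular_pendant[OF u last_in_spiral_V[OF m] fresh(1)]
  note u2 = unicellular_pendant[OF u1 insertI1 fresh(2)]
  have e: "?e \<in> ?V" by (rule spiral_end_in[OF m])
  then have ne: "?e \<noteq> ?w1" "?e \<noteq> ?w2" using fresh by auto
  have "{?w2, ?e} \<notin> ?E" using edge_notin[OF spiral_wf[OF m]] fresh by blast
  then have new: "{?w2, ?e} \<notin> insert {?w1, ?w2} (insert {m + 2 * n, ?w1} ?E)"
    using ne by (auto simp: doubleton_eq_iff)
  show ?thesis
    unfolding near_unicellular_def spiral_V_Suc spiral_E_Suc
    using u2 new e ne
    by (intro exI[of _ "insert {?w1, ?w2} (insert {m + 2 * n, ?w1} ?E)"] exI[of _ ?w2] exI[of _ ?e])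
      simp
qed

text \<open>The ear is laid backwards from \<open>1\<close> over \<open>m + 2\<close> to
  \<open>m + 1\<close>. The two missing edges, \<open>{m, 1}\<close> and \<open>{m, m + 1}\<close>,
  then share the endpoint \<open>m\<close>.\<close>

lemma spiral_1_unicellular:
  assumes m: "3 \<le> m"
  shows "unicellular (spiral_V m 1) (spiral_E m 1)"
proof -
  have u: "unicellular {1..m} (path_E m)" using path_unicellular[of m] m by simp
  have mem: "1 \<in> {1..m}" "m + 2 \<notin> {1..m}" "m + 1 \<notin> insert (m + 2) {1..m}" using m by auto
  note u1 = unicellular_pendant[OF u mem(1,2)]
  note u2 = unicellular_pendant[OF u1 insertI1 mem(3)]
  have "{m, 1} \<notin> path_E m" "{m, m + 1} \<notin> path_E m"
    using m by (auto simp: path_E_def doubleton_eq_iff)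
  then have "unicellular (insert (m + 1) (insert (m + 2) {1..m}))
    (insert {m, 1} (insert {m, m + 1} (insert {m + 2, m + 1} (insert {1, m + 2} (path_E m)))))"
    using m by (intro unicellular_add_adjacent_edges u2) (auto simp: doubleton_eq_iff)
  moreover have "spiral_V m 1 = insert (m + 1) (insert (m + 2) {1..m})"
    by (auto simp: spiral_V_def)
  moreover have "spiral_E m 1 =
    insert {m, 1} (insert {m, m + 1} (insert {m + 2, m + 1} (insert {1, m + 2} (path_E m))))"
    using spiral_E_Suc[of m 0] m by (auto simp: spiral_E_0 spiral_end_def insert_commute)
  ultimately show ?thesis by simp
qed

lemma spiral_Suc_Suc_unicellular:
  assumes m: "3 \<le> m" and u: "unicellular (spiral_V m n) (spiral_E m n)"
  shows "unicellular (spiral_V m (Suc (Suc n))) (spiral_E m (Suc (Suc n)))"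
proof -
  let ?V = "spiral_V m n" and ?E = "spiral_E m n"
  let ?e1 = "spiral_end m (Suc n)" and ?e2 = "spiral_end m (Suc (Suc n))"
  define w0 w1 w2 w3 w4 where w: "w0 = m + 2 * n" "w1 = m + 2 * n + 1" "w2 = m + 2 * n + 2"
    "w3 = m + 2 * n + 3" "w4 = m + 2 * n + 4"
  have fresh: "w1 \<notin> ?V" "w2 \<notin> ?V" "w3 \<notin> ?V" "w4 \<notin> ?V"
    by (auto simp: spiral_V_def w)
  have dist: "distinct [w0, w1, w2, w3, w4]" by (simp add: w)
  have w0: "w0 \<in> ?V" using last_in_spiral_V[OF m] by (simp add: w)
  have e: "?e1 \<in> ?V" "?e2 \<in> ?V" by (rule spiral_end_in[OF m])+
  have "unicellular (insert w1 ?V) (insert {w0, w1} ?E)"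
    using u w0 fresh(1) by (rule unicellular_pendant)
  then have "unicellular (insert w2 (insert w1 ?V)) (insert {w1, w2} (insert {w0, w1} ?E))"
    by (rule unicellular_pendant) (use fresh dist in auto)
  \<comment> \<open>The second ear is laid from its far end \<open>?e2\<close> back to
    \<open>w3\<close>. What is still missing are \<open>{w2, ?e1}\<close> and
    \<open>{w2, w3}\<close>, which meet in \<open>w2\<close>.\<close>
  then have "unicellular (insert w4 (insert w2 (insert w1 ?V)))
      (insert {?e2, w4} (insert {w1, w2} (insert {w0, w1} ?E)))"
    by (rule unicellular_pendant) (use fresh dist e in auto)
  then have "unicellular (insert w3 (insert w4 (insert w2 (insert w1 ?V))))
      (insert {w4, w3} (insert {?e2, w4} (insert {w1, w2} (insert {w0, w1} ?E))))"
    by (rule unicellular_pendant) (use fresh dist in auto)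
  moreover have "{w2, ?e1} \<notin> ?E" "{w2, w3} \<notin> ?E"
    using edge_notin[OF spiral_wf[OF m]] fresh by blast+
  moreover have "w1 \<noteq> ?e1" "w2 \<noteq> ?e1" "w3 \<noteq> ?e1" "w4 \<noteq> ?e1"
    "w1 \<noteq> ?e2" "w2 \<noteq> ?e2" "w3 \<noteq> ?e2" "w4 \<noteq> ?e2"
    using fresh e by metis+
  ultimately have "unicellular (insert w3 (insert w4 (insert w2 (insert w1 ?V))))
      (insert {w2, ?e1} (insert {w2, w3}
        (insert {w4, w3} (insert {?e2, w4} (insert {w1, w2} (insert {w0, w1} ?E))))))"
    using dist e by (intro unicellular_add_adjacent_edges) (auto simp: doubleton_eq_iff)
  moreover have "spiral_V m (Suc (Suc n)) = insert w3 (insert w4 (insert w2 (insert w1 ?V)))"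
    by (auto simp: spiral_V_Suc w)
  moreover have "spiral_E m (Suc (Suc n)) = insert {w2, ?e1} (insert {w2, w3}
        (insert {w4, w3} (insert {?e2, w4} (insert {w1, w2} (insert {w0, w1} ?E)))))"
  proof -
    have "m + 2 * Suc n = w2" "m + 2 * Suc n + 1 = w3" "m + 2 * Suc n + 2 = w4"
      "m + 2 * n = w0" "m + 2 * n + 1 = w1" "m + 2 * n + 2 = w2" by (simp_all add: w)
    then show ?thesis unfolding spiral_E_Suc by (simp add: insert_commute)
  qed
  ultimately show ?thesis by simp
qed

text \<open>Odd \<open>n\<close> is reached from \<open>1\<close> in steps of two ears; a positive
  even \<open>n\<close> is one ear beyond an odd spiral. The case \<open>n = 0\<close> is kept
  because deletion from two ears leads back to it.\<close>

lemma spiral_unicellular: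
  assumes m: "3 \<le> m"
  shows "if odd n then unicellular (spiral_V m n) (spiral_E m n)
    else near_unicellular (spiral_V m n) (spiral_E m n)"
proof -
  have odd: "unicellular (spiral_V m (2 * k + 1)) (spiral_E m (2 * k + 1))" for k
    by (induction k) (use spiral_1_unicellular[OF m] spiral_Suc_Suc_unicellular[OF m] in auto)
  show ?thesis
  proof (cases "odd n")
    case True
    then show ?thesis using odd by (auto elim!: oddE)
  next
    case False
    show ?thesis
    proof (cases n)
      case 0
      then show ?thesis using spiral_0_near_unicellular[OF m] by simp
    next
      case (Suc l)
      with False have "odd l" by simp
      then have "unicellular (spiral_V m l) (spiral_E m l)" using odd by (auto elim!: oddE)
      then show ?thesis using spiral_Suc_near_unicellular[OF m] False Suc by simp
    qed
  qed
qed

lemma max_genus_eq_betti_div_2: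
  assumes "if odd n then unicellular V E else near_unicellular V E" "even (betti V E) \<longleftrightarrow> odd n"
  shows "connected_graph V E \<and> max_genus V E = betti V E div 2"
  using assms unicellular_max_genus near_unicellular_max_genus near_unicellular_connected
  by (auto simp: unicellular_def split: if_splits)

section \<open>Deletion of the critical vertex\<close>

text \<open>For \<open>n = 1\<close> the vertex is \<open>m\<close>. What remains is one path: from
  \<open>m - 1\<close> down to \<open>1\<close>, then \<open>m + 2\<close> and
  \<open>m + 1\<close>.\<close>

lemma spiral_1_del_vertex:
  assumes m: "3 \<le> m"
  shows "unicellular (spiral_V m 1 - {m}) (del_vertex_E (spiral_E m 1) m) \<and>
    betti (spiral_V m 1 - {m}) (del_vertex_E (spiral_E m 1) m) = 0"
proof -
  obtain k where k: "m = Suc k" "2 \<le> k" using m by (cases m) auto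
  let ?V = "{1..k}" and ?E = "path_E k"
  have u: "unicellular ?V ?E" and b: "betti ?V ?E = 0" using path_unicellular[OF k(2)] by auto
  have mem: "1 \<in> ?V" "m + 2 \<notin> ?V" "m + 1 \<notin> insert (m + 2) ?V" using k by auto
  note u1 = unicellular_pendant[OF u mem(1,2)]
  note u2 = unicellular_pendant[OF u1 insertI1 mem(3)]
  have "betti (insert (m + 1) (insert (m + 2) ?V)) (insert {m + 2, m + 1} (insert {1, m + 2} ?E)) = 0"
    using b betti_pendant[OF unicellular_wf[OF u] mem(2)]
      betti_pendant[OF unicellular_wf[OF u1] mem(3)] by simp
  moreover have "spiral_V m 1 - {m} = insert (m + 1) (insert (m + 2) ?V)"
    using k by (auto simp: spiral_V_def)
  moreover have "del_vertex_E (spiral_E m 1) m = insert {m + 2, m + 1} (insert {1, m + 2} ?E)"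
  proof -
    have "m \<notin> e" if "e \<in> ?E" for e
      using edge_avoids[OF unicellular_wf[OF u] _ that] k by simp
    moreover have "spiral_E m 1 = insert {m + 2, 1} (insert {m + 1, m + 2}
        (insert {m, m + 1} (insert {m, 1} (insert {k, m} ?E))))"
      using spiral_E_Suc[of m 0] path_E_Suc[of k] k by (simp add: spiral_E_0 spiral_end_def)
    ultimately show ?thesis using k by (auto simp: del_vertex_E_def insert_commute)
  qed
  ultimately show ?thesis using u2 by simp
qed

text \<open>With \<open>n + 2\<close> ears the vertex is the junction \<open>w2\<close> of the last
  two. Its removal opens both: \<open>w1\<close> hangs on \<open>w0\<close>, and the path
  \<open>w4\<close>, \<open>w3\<close> hangs on \<open>?e2\<close>.\<close>

lemma spiral_Suc_Suc_del_vertex: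
  fixes n :: nat
  assumes m: "3 \<le> m"
  defines "V \<equiv> spiral_V m (Suc (Suc n)) - {m + 2 * n + 2}"
    and "E \<equiv> del_vertex_E (spiral_E m (Suc (Suc n))) (m + 2 * n + 2)"
  shows "(if odd n then unicellular V E else near_unicellular V E) \<and> betti V E = int n + 1"
proof -
  let ?V = "spiral_V m n" and ?E = "spiral_E m n"
  let ?e1 = "spiral_end m (Suc n)" and ?e2 = "spiral_end m (Suc (Suc n))"
  define w0 w1 w2 w3 w4 where w: "w0 = m + 2 * n" "w1 = m + 2 * n + 1" "w2 = m + 2 * n + 2"
    "w3 = m + 2 * n + 3" "w4 = m + 2 * n + 4"
  have fresh: "w1 \<notin> ?V" "w2 \<notin> ?V" "w4 \<notin> insert w1 ?V" "w3 \<notin> insert w4 (insert w1 ?V)"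
    by (auto simp: spiral_V_def w)
  have w0: "w0 \<in> ?V" using last_in_spiral_V[OF m] by (simp add: w)
  have e: "?e1 \<in> ?V" "?e2 \<in> insert w1 ?V" "?e2 \<noteq> w2" using spiral_end_in[OF m] fresh by auto
  let ?V1 = "insert w1 ?V" and ?E1 = "insert {w0, w1} ?E"
  let ?V2 = "insert w4 ?V1" and ?E2 = "insert {?e2, w4} ?E1"
  let ?V3 = "insert w3 ?V2" and ?E3 = "insert {w4, w3} ?E2"
  have V: "V = ?V3"
    using fresh(2) by (auto simp: V_def spiral_V_Suc w)
  have E: "E = ?E3"
  proof -
    have "w2 \<notin> f" if "f \<in> ?E" for f
      by (rule edge_avoids[OF spiral_wf[OF m] fresh(2) that])
    moreover have "m + 2 * Suc n = w2" "m + 2 * Suc n + 1 = w3" "m + 2 * Suc n + 2 = w4"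
      "m + 2 * n = w0" "m + 2 * n + 1 = w1" "m + 2 * n + 2 = w2" by (simp_all add: w)
    moreover have "w0 \<noteq> w2" "w1 \<noteq> w2" "w3 \<noteq> w2" "w4 \<noteq> w2" by (auto simp: w)
    ultimately show ?thesis using e(3)
      unfolding E_def del_vertex_E_def spiral_E_Suc by (auto simp: insert_commute)
  qed
  note wf0 = spiral_wf[OF m, of n]
  note wf1 = wf_graph_pendant[OF wf0 w0 fresh(1)]
  note wf2 = wf_graph_pendant[OF wf1 e(2) fresh(3)]
  have "betti V E = int n + 1"
    using spiral_betti[OF m, of n] betti_pendant[OF wf0 fresh(1)] betti_pendant[OF wf1 fresh(3)]
      betti_pendant[OF wf2 fresh(4)] by (simp add: V E)
  moreover have "unicellular V E" if u: "unicellular ?V ?E"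
    unfolding V E
    by (rule unicellular_pendant[OF unicellular_pendant[OF unicellular_pendant[OF u w0 fresh(1)]
          e(2) fresh(3)] insertI1 fresh(4)])
  moreover have "near_unicellular V E" if u: "near_unicellular ?V ?E"
    unfolding V E
    by (rule near_unicellular_pendant[OF near_unicellular_pendant[OF near_unicellular_pendant[OF
          u w0 fresh(1)] e(2) fresh(3)] insertI1 fresh(4)])
  ultimately show ?thesis using spiral_unicellular[OF m, of n] by (auto split: if_splits)
qed

theorem theorem3p2:
  fixes m n :: nat
  assumes "m \<ge> 3" and "n \<ge> 1"
  shows "upper_embeddable (spiral_V m n) (spiral_E m n)
       \<and> max_genus (spiral_V m n) (spiral_E m n) = int ((n + 1) div 2)
       \<and> one_critical_vertex (spiral_V m n) (spiral_E m n) (m + 2 * n - 2)"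
proof -
  let ?V = "spiral_V m n" and ?E = "spiral_E m n" and ?v = "m + 2 * n - 2"
  have b: "betti ?V ?E = int n + 1" by (rule spiral_betti[OF assms(1)])
  have g: "max_genus ?V ?E = betti ?V ?E div 2"
    using max_genus_eq_betti_div_2[OF spiral_unicellular[OF assms(1)]] b by simp
  \<comment> \<open>Deletion lowers the Betti number from \<open>n + 1\<close> to
    \<open>n - 1\<close> in both cases: to \<open>0\<close> for \<open>n = 1\<close>, and to
    \<open>k + 1\<close> for \<open>n = k + 2\<close>.\<close>
  have "connected_graph (?V - {?v}) (del_vertex_E ?E ?v) \<and>
    max_genus (?V - {?v}) (del_vertex_E ?E ?v) = (int n - 1) div 2"
  proof (cases "n = 1")
    case True
    then show ?thesis
      using spiral_1_del_vertex[OF assms(1)] unicellular_max_genus by (simp add: unicellular_def)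
  next
    case False
    with assms(2) have "n = Suc (Suc (n - 2))" by simp
    then obtain k where k: "n = Suc (Suc k)" by blast
    have v: "?v = m + 2 * k + 2" using k by simp
    note del = spiral_Suc_Suc_del_vertex[OF assms(1), of k, folded k v]
    show ?thesis
      using max_genus_eq_betti_div_2[OF conjunct1[OF del]] conjunct2[OF del] k by simp
  qed
  moreover have "?v \<in> ?V" using assms by (auto simp: spiral_V_def)
  moreover have "(int n - 1) div 2 = (int n + 1) div 2 - 1" by presburger
  moreover have "int ((n + 1) div 2) = (int n + 1) div 2" by (simp add: zdiv_int)
  ultimately show ?thesis
    using b g by (simp add: upper_embeddable_def one_critical_vertex_def)
qed

end
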